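(* There exist a probability space $(\Omega,\mathcal{F},\mathbf{P})$, a totally ordered set $(\mathcal{O},\preceq)$, and an increasing $\mathcal{O}$-family of $\mathcal{F}$-sets $(A_t)_{t\in\mathcal{O}}$ (with $\bigcup_{t\in\mathcal{O}}A_t\in\mathcal{F}$, so that its probability is defined) such that $$\mathbf{P}\left(\bigcup_{t\in\mathcal{O}} A_t\right) > \sup_{t\in\mathcal{O}}\mathbf{P}(A_t).$$
   Context: Given a measure space $(S,\mathcal{F},\mu)$ and a totally ordered index set $(\mathcal{O},\preceq)$, an increasing $\mathcal{O}$-family of $\mathcal{F}$-sets is a collection $(A_t)_{t\in\mathcal{O}}$ of $\mathcal{F}$-measurable sets such that $A_s\subseteq A_t$ whenever $s\preceq t$. *)

theory Defs
  imports "HOL-Probability.Probability"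
begin

(* The relation r orders the index set T; "linear_order_on T r" is stated
   separately wherever total orderedness of the index set is required. *)

definition increasing_family ::
  "'a measure \<Rightarrow> 'i set \<Rightarrow> ('i \<times> 'i) set \<Rightarrow> ('i \<Rightarrow> 'a set) \<Rightarrow> bool"
where
  "increasing_family M T r A \<longleftrightarrow>
     (\<forall>t\<in>T. A t \<in> sets M) \<and>
     (\<forall>s\<in>T. \<forall>t\<in>T. (s, t) \<in> r \<longrightarrow> A s \<subseteq> A t)"

end

theory Submission
  imports Defs
begin

text \<open>
  Continuity from below fails for uncountable chains as soon as an uncountable set is exhausted by
  a chain of countable sets while the measure only distinguishes countable sets from co-countable
  ones. The classical instance is the first uncountable ordinal: every initial segment is countable,
  hence null for the countable/co-countable probability measure, yet the segments cover the whole
  space, which has probability one.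

  A copy of the first uncountable ordinal sits inside the reals without any appeal to the continuum
  hypothesis: well-order the reals and keep only the points with countably many predecessors
  (\<open>ex_uncountable_countable_initial_segments\<close>). Taking this set as the space of the measure
  (\<open>prob_space_cocountable_measure\<close>), rather than as a subset of an interval with Lebesgue
  measure, spares any question about its measurability.
\<close>

section \<open>Uncountable orders with countable initial segments\<close>

text \<open>
  The points with countably many predecessors form an initial segment. If it were countable, the
  least point outside it would have only countably many predecessors and would thus belong to it.
\<close>
lemma ex_uncountable_countable_initial_segments:
  fixes S :: "'a set"
  assumes "uncountable S"
  obtains T r where "T \<subseteq> S" "uncountable T" "linear_order_on T r"
    "\<And>t. t \<in> T \<Longrightarrow> countable {s. (s, t) \<in> r}"
proof -
  obtain R where wo: "well_order_on S R"
    using well_order_on by blast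
  have lin: "linear_order_on S R" and wf: "wf (R - Id)"
    using wo by (auto simp: well_order_on_def)
  have trans: "trans R" and refl: "refl_on S R" and sub: "R \<subseteq> S \<times> S" and total: "total_on S R"
    and antisym: "antisym R"
    using lin by (auto simp: order_on_defs)
  define T where "T = {t \<in> S. countable {s. (s, t) \<in> R}}"
  have "T \<subseteq> S"
    by (auto simp: T_def)
  moreover have "uncountable T"
  proof
    assume "countable T"
    then have "S - T \<noteq> {}"
      using assms \<open>T \<subseteq> S\<close> by auto
    then obtain x where x: "x \<in> S - T" and least: "\<And>y. (y, x) \<in> R - Id \<Longrightarrow> y \<notin> S - T"
      using wf by (metis ex_in_conv wfE_min)
    have "{s. (s, x) \<in> R} \<subseteq> insert x T"
      using least sub by blast
    then have "countable {s. (s, x) \<in> R}"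
      using \<open>countable T\<close> by (meson countable_insert countable_subset)
    then show False
      using x by (auto simp: T_def)
  qed
  moreover have "linear_order_on T (R \<inter> T \<times> T)"
    unfolding order_on_defs
    using refl total \<open>T \<subseteq> S\<close>
    by (auto simp: refl_on_def total_on_def subset_iff intro: trans_Restr[OF trans] antisym_subset[OF _ antisym])
  moreover have "countable {s. (s, t) \<in> R \<inter> T \<times> T}" if "t \<in> T" for t
    by (rule countable_subset[of _ "{s. (s, t) \<in> R}"]) (use that in \<open>auto simp: T_def\<close>)
  ultimately show thesis
    by (rule that)
qed

section \<open>The countable/co-countable probability measure\<close>

definition cocountable_sets :: "'a set \<Rightarrow> 'a set set" where
  "cocountable_sets X = {A. A \<subseteq> X \<and> (countable A \<or> countable (X - A))}"

definition cocountable_measure :: "'a set \<Rightarrow> 'a measure" where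
  "cocountable_measure X =
     measure_of X (cocountable_sets X) (\<lambda>A. if countable A then 0 else 1)"

lemma sigma_algebra_cocountable_sets: "sigma_algebra X (cocountable_sets X)"
  unfolding sigma_algebra_iff2
proof (intro conjI ballI allI impI)
  show "cocountable_sets X \<subseteq> Pow X" and "{} \<in> cocountable_sets X"
    by (auto simp: cocountable_sets_def)
next
  fix A assume "A \<in> cocountable_sets X"
  then show "X - A \<in> cocountable_sets X"
    by (auto simp: cocountable_sets_def double_diff)
next
  fix A :: "nat \<Rightarrow> 'a set"
  assume "range A \<subseteq> cocountable_sets X"
  then have A: "A i \<subseteq> X" "countable (A i) \<or> countable (X - A i)" for i
    by (auto simp: cocountable_sets_def)
  have "countable (\<Union>i. A i) \<or> countable (X - (\<Union>i. A i))"
  proof (cases "\<forall>i. countable (A i)")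
    case False
    then obtain i where "countable (X - A i)"
      using A by blast
    then show ?thesis
      by (metis Diff_mono UN_upper UNIV_I countable_subset order_refl)
  qed auto
  then show "(\<Union>i. A i) \<in> cocountable_sets X"
    using A by (auto simp: cocountable_sets_def)
qed

lemma sets_cocountable_measure [simp]: "sets (cocountable_measure X) = cocountable_sets X"
  using sigma_algebra.sets_measure_of_eq[OF sigma_algebra_cocountable_sets]
  by (simp add: cocountable_measure_def)

lemma space_cocountable_measure [simp]: "space (cocountable_measure X) = X"
  by (simp add: cocountable_measure_def space_measure_of_conv)

text \<open>
  Additivity rests on the fact that two disjoint subsets of an uncountable set cannot both be
  co-countable, so a disjoint sequence has at most one member of measure one.
\<close>
lemma emeasure_cocountable_measure:
  assumes "uncountable X" and "A \<in> cocountable_sets X"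
  shows "emeasure (cocountable_measure X) A = (if countable A then 0 else 1)"
  unfolding cocountable_measure_def
proof (rule emeasure_measure_of_sigma[OF sigma_algebra_cocountable_sets])
  let ?\<mu> = "\<lambda>A :: 'a set. if countable A then 0 else 1 :: ennreal"
  show "positive (cocountable_sets X) ?\<mu>"
    by (simp add: positive_def)
  show "countably_additive (cocountable_sets X) ?\<mu>"
  proof (rule countably_additiveI)
    fix A :: "nat \<Rightarrow> 'a set"
    assume A: "range A \<subseteq> cocountable_sets X" and disj: "disjoint_family A"
    show "(\<Sum>i. ?\<mu> (A i)) = ?\<mu> (\<Union>i. A i)"
    proof (cases "\<forall>i. countable (A i)")
      case True
      then show ?thesis by simp
    next
      case False
      then obtain i where i: "uncountable (A i)"
        by blast
      then have co: "countable (X - A i)"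
        using A by (auto simp: cocountable_sets_def)
      have null: "countable (A j)" if "j \<noteq> i" for j
      proof (rule countable_subset[OF _ co])
        have "A j \<inter> A i = {}"
          using disj that by (auto simp: disjoint_family_on_def)
        moreover have "A j \<subseteq> X"
          using A by (auto simp: cocountable_sets_def)
        ultimately show "A j \<subseteq> X - A i"
          by blast
      qed
      have "(\<Sum>j. ?\<mu> (A j)) = (\<Sum>j\<in>{i}. ?\<mu> (A j))"
        by (rule suminf_finite) (use null in auto)
      moreover have "uncountable (\<Union>i. A i)"
        using i by (meson UN_upper UNIV_I countable_subset)
      ultimately show ?thesis
        using i by simp
    qed
  qed
qed (fact assms(2))

lemma prob_space_cocountable_measure:
  assumes "uncountable X"
  shows "prob_space (cocountable_measure X)"
  by (rule prob_spaceI)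
     (use assms in \<open>simp add: emeasure_cocountable_measure cocountable_sets_def\<close>)

section \<open>Failure of continuity along an uncountable chain\<close>

theorem theorem2:
  shows "\<exists>(M :: real measure) (T :: real set) (r :: (real \<times> real) set) (A :: real \<Rightarrow> real set).
           prob_space M \<and> linear_order_on T r \<and> increasing_family M T r A \<and>
           (\<Union>t\<in>T. A t) \<in> sets M \<and>
           emeasure M (\<Union>t\<in>T. A t) > (SUP t\<in>T. emeasure M (A t))"
proof -
  obtain T :: "real set" and r where unc: "uncountable T" and lin: "linear_order_on T r"
    and seg: "\<And>t. t \<in> T \<Longrightarrow> countable {s. (s, t) \<in> r}"
    using ex_uncountable_countable_initial_segments[OF uncountable_UNIV_real] by metis
  let ?M = "cocountable_measure T" and ?A = "\<lambda>t. {s. (s, t) \<in> r}"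
  have r: "r \<subseteq> T \<times> T" "refl_on T r" "trans r"
    using lin by (auto simp: order_on_defs)
  have A: "?A t \<in> cocountable_sets T" if "t \<in> T" for t
    using seg[OF that] r(1) by (auto simp: cocountable_sets_def)
  have Un: "(\<Union>t\<in>T. ?A t) = T"
    using r(1,2) by (auto simp: refl_on_def)
  have T: "T \<in> cocountable_sets T"
    by (simp add: cocountable_sets_def)
  have "increasing_family ?M T r ?A"
    using A r(3) by (auto simp: increasing_family_def dest: transD)
  moreover have "(SUP t\<in>T. emeasure ?M (?A t)) = (SUP t\<in>T. 0)"
    by (rule SUP_cong) (auto simp: emeasure_cocountable_measure[OF unc A] seg)
  then have "(SUP t\<in>T. emeasure ?M (?A t)) < emeasure ?M (\<Union>t\<in>T. ?A t)"
    unfolding Un using unc T by (simp add: emeasure_cocountable_measure SUP_constant bot_ennreal)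
  ultimately show ?thesis
    using prob_space_cocountable_measure[OF unc] lin Un T
    by (intro exI[of _ ?M] exI[of _ T] exI[of _ r] exI[of _ ?A]) simp
qed

end
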